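(* Let $C$ be a nonempty closed convex subset of a real Hilbert space $H$ and $T$ a Lipschitz pseudo-contraction from $C$ into itself with Lipschitz constant $L\ge1$ and $F(T)\ne\emptyset$. Assume $\{\tau_n\}_{n\ge0}\subset[\tau,1]$ with $\tau\in(0,1]$, $\{\alpha_n\}_{n\ge0}\subset[a,b]$ with $a,b\in(0,\frac1{L+1})$, and $\beta_n\in[0,1]$ for all $n\ge0$. Let $x_0\in C$ be arbitrary and let $\{x_n\}$ be generated, for $n\ge0$, by $$y_n=(1-\beta_n)x_0+\beta_nTx_n,\qquad v_n=(1-\alpha_n)x_n+\alpha_nTx_n,$$ $$C_n'=\{z\in C:\tau_n\alpha_n[1-(1+L)\alpha_n]\|x_n-Tx_n\|^2\le\langle x_n-z,v_n-Tv_n\rangle\},$$ $$C_n''=\{z\in C:\|y_n-z\|^2\le\|x_n-z\|^2+2(1-\beta_n)\langle x_n-x_0,z\rangle+\theta_n\},$$ $$C_n=C_n'\cap C_n'',$$ $$Q_n=\{z\in C:\langle z-x_n,x_n-x_0\rangle\ge0\},$$ $$x_{n+1}=P_{C_n^*\cap Q_n}x_0,$$ where $C_n^*$ is a closed convex set with $F(T)\subset C_n^*\subset C_n$ and $$\theta_n=(1-\beta_n)(\|x_0\|^2-\|x_n\|^2)+\beta_n\|x_n-Tx_n\|^2-\beta_n(1-\beta_n)\|x_0-Tx_n\|^2.$$ Then $\{x_n\}$ converges strongly to $P_{F(T)}x_0$.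
   Context: $F(T)=\{x\in C:Tx=x\}$. $T$ is a pseudo-contraction if $\|Tx-Ty\|^2\le\|x-y\|^2+\|(I-T)x-(I-T)y\|^2$ for all $x,y\in C$ ($I$ the identity). $T$ is Lipschitz with constant $L$ if $\|Tx-Ty\|\le L\|x-y\|$ for all $x,y\in C$. For a nonempty closed convex set $D\subset H$, $P_D$ is the metric projection (nearest-point map) onto $D$. *)

theory Defs
  imports "HOL-Analysis.Analysis"
begin

definition fixed_points :: "'a set \<Rightarrow> ('a \<Rightarrow> 'a) \<Rightarrow> 'a set"
  where "fixed_points C T = {x \<in> C. T x = x}"

definition pseudo_contraction_on :: "'a::real_inner set \<Rightarrow> ('a \<Rightarrow> 'a) \<Rightarrow> bool"
  where "pseudo_contraction_on C T \<longleftrightarrow>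
    (\<forall>x\<in>C. \<forall>y\<in>C. (norm (T x - T y))\<^sup>2
       \<le> (norm (x - y))\<^sup>2 + (norm ((x - T x) - (y - T y)))\<^sup>2)"

(* The library's closest_point requires the class heine_borel, which excludes
   infinite-dimensional spaces. The value below is meaningful only when the
   nearest point exists and is unique, e.g. for D nonempty, closed and convex
   in a Hilbert space. *)
definition metric_proj :: "'a::real_inner set \<Rightarrow> 'a \<Rightarrow> 'a"
  where "metric_proj D x = (THE p. p \<in> D \<and> (\<forall>z\<in>D. norm (x - p) \<le> norm (x - z)))"

end

theory Submission
  imports Defs
begin

text \<open>
Write \<open>u = x 0\<close>, \<open>F\<close> for the set of fixed points and \<open>q\<close> for the projection of \<open>u\<close> onto \<open>F\<close>.
Each \<open>x (n + 1)\<close> is the projection of \<open>u\<close> onto a set that contains \<open>F\<close>: the variational inequality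
of the projection \<open>x (n + 1)\<close> says exactly that the next half-space \<open>Q (n + 1)\<close> still contains \<open>F\<close>.
Hence \<open>norm (x n - u) \<le> norm (q - u)\<close> throughout. Since \<open>x (n + 1)\<close> lies in \<open>Q n\<close>, whose nearest
point to \<open>u\<close> is \<open>x n\<close>, Pythagoras bounds \<open>(norm (x (n + 1) - x n))\<^sup>2\<close> by the increment of the bounded
monotone sequence \<open>(norm (x n - u))\<^sup>2\<close>, so consecutive differences tend to 0. As \<open>x (n + 1)\<close> also lies
in \<open>C' n\<close>, the residual \<open>norm (x n - T (x n))\<close> is controlled by such a difference and tends to 0 too.

It remains to pass to the limit, which is usually done by weak compactness and demiclosedness of
\<open>I - T\<close>. Here weak cluster points are replaced by the points common to the closed convex hulls
\<open>K n\<close> of the tails \<open>{x n, x (n + 1), \<dots>}\<close>. The map \<open>A = I - T\<close> is monotone, so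
\<open>inner (A y) (y - x n) \<ge> inner (A (x n)) (y - x n)\<close>, and the right-hand side tends to 0. The left-hand side is
affine in \<open>x n\<close>, so a point \<open>z\<close> common to all \<open>K n\<close> satisfies \<open>inner (A y) (y - z) \<ge> 0\<close> for every
\<open>y\<close> in \<open>C\<close>. By Minty's argument these inequalities characterise fixed points
(\<open>fixed_points_eq_halfspaces\<close>), which also shows that \<open>F\<close> is closed and convex. Thus the
intersection of the \<open>K n\<close> lies in \<open>F\<close> (\<open>tail_hull_points_are_fixed\<close>), and
\<open>nested_convex_convergence\<close> turns this and \<open>norm (x n - u) \<le> norm (q - u)\<close> into norm convergence
to \<open>q\<close>: the nearest points of the \<open>K n\<close> to \<open>u\<close> form a Cauchy sequence with limit \<open>q\<close>, and \<open>x n\<close> is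
squeezed towards them.
\<close>

section \<open>Nearest points in Hilbert spaces\<close>

text \<open>
By the parallelogram law, two points that are almost as close to \<open>u\<close> as their midpoint is are
close to each other. This is the Cauchy estimate for minimising sequences.
\<close>
lemma norm_diff_le_of_midpoint_far:
  fixes p q u :: "'a::real_inner"
  assumes "d \<le> norm ((p + q) /\<^sub>R 2 - u)" and "0 \<le> d"
    and "norm (p - u) \<le> r" and "norm (q - u) \<le> r"
  shows "(norm (p - q))\<^sup>2 \<le> 4 * (r\<^sup>2 - d\<^sup>2)"
proof -
  have "(p + q) /\<^sub>R 2 - u = ((p - u) + (q - u)) /\<^sub>R 2"
    by (simp add: algebra_simps flip: scaleR_add_left)
  then have "norm ((p - u) + (q - u)) = 2 * norm ((p + q) /\<^sub>R 2 - u)"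
    by simp
  moreover have "(norm ((p - u) + (q - u)))\<^sup>2 + (norm (p - q))\<^sup>2
      = 2 * (norm (p - u))\<^sup>2 + 2 * (norm (q - u))\<^sup>2"
    by (simp add: power2_norm_eq_inner algebra_simps inner_commute)
  moreover have "(norm (p - u))\<^sup>2 \<le> r\<^sup>2" "(norm (q - u))\<^sup>2 \<le> r\<^sup>2"
      "d\<^sup>2 \<le> (norm ((p + q) /\<^sub>R 2 - u))\<^sup>2"
    using assms by (auto intro: power_mono)
  ultimately show ?thesis
    by (simp add: power_mult_distrib)
qed

text \<open>
The parts of \<open>S\<close> within distance \<open>d + 1 / (n + 1)\<close> of \<open>u\<close>, where \<open>d\<close> is the infimal distance,
are nested closed sets. By convexity midpoints stay in \<open>S\<close>, so the diameters of these parts tend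
to 0, and completeness yields a common point.
\<close>
lemma nearest_point_exists:
  fixes S :: "'a::{real_inner, complete_space} set"
  assumes "closed S" "convex S" "S \<noteq> {}"
  obtains p where "p \<in> S" "\<And>z. z \<in> S \<Longrightarrow> norm (u - p) \<le> norm (u - z)"
proof -
  define d where "d = infdist u S"
  have d0: "0 \<le> d" by (simp add: d_def infdist_nonneg)
  have dle: "d \<le> norm (z - u)" if "z \<in> S" for z
    using infdist_le[OF that, of u] by (simp add: d_def dist_norm norm_minus_commute)
  define W where "W n = S \<inter> cball u (d + 1 / Suc n)" for n
  obtain p where p: "\<And>n. p \<in> W n"
  proof (rule decreasing_closed_nest[of W])
    show "closed (W n)" for n
      using assms(1) by (auto simp: W_def)
    show "W n \<noteq> {}" for n
    proof -
      have "infdist u S < d + 1 / Suc n" by (simp add: d_def)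
      then obtain z where "z \<in> S" "dist u z < d + 1 / Suc n"
        unfolding infdist_notempty[OF assms(3)]
        by (subst (asm) cINF_less_iff) (auto simp: assms(3))
      then show ?thesis by (auto simp: W_def)
    qed
    show "W n \<subseteq> W m" if "m \<le> n" for m n
    proof -
      have "1 / real (Suc n) \<le> 1 / real (Suc m)"
        using that by (simp add: frac_le)
      then show ?thesis by (auto simp: W_def)
    qed
    show "\<exists>n. \<forall>x\<in>W n. \<forall>y\<in>W n. dist x y < e" if "e > 0" for e
    proof -
      have "(\<lambda>n. 4 * ((d + 1 / real (Suc n))\<^sup>2 - d\<^sup>2)) \<longlonglongrightarrow> 4 * ((d + 0)\<^sup>2 - d\<^sup>2)"
        by (intro tendsto_intros LIMSEQ_Suc[OF lim_1_over_n])
      then have "\<forall>\<^sub>F n in sequentially. 4 * ((d + 1 / real (Suc n))\<^sup>2 - d\<^sup>2) < e\<^sup>2"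
        using that by (intro order_tendstoD(2)) auto
      then obtain n where n: "4 * ((d + 1 / real (Suc n))\<^sup>2 - d\<^sup>2) < e\<^sup>2"
        by (auto simp: eventually_sequentially)
      have "dist x y < e" if "x \<in> W n" "y \<in> W n" for x y
      proof -
        have "(x + y) /\<^sub>R 2 \<in> S"
          using that convexD[OF assms(2), of x y "1/2" "1/2"]
          by (simp add: W_def scaleR_add_right)
        from norm_diff_le_of_midpoint_far[OF dle[OF this] d0, of "d + 1 / Suc n"]
        have "(norm (x - y))\<^sup>2 < e\<^sup>2"
          using that n by (force simp: W_def dist_norm norm_minus_commute)
        then show ?thesis
          using \<open>e > 0\<close> by (simp add: dist_norm power2_less_imp_less)
      qed
      then show ?thesis by blast
    qed
  qed blast
  have "dist u p \<le> d"
  proof (rule LIMSEQ_le_const)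
    have "(\<lambda>n. d + 1 / real (Suc n)) \<longlonglongrightarrow> d + 0"
      by (intro tendsto_intros LIMSEQ_Suc[OF lim_1_over_n])
    then show "(\<lambda>n. d + 1 / real (Suc n)) \<longlonglongrightarrow> d" by simp
    show "\<exists>N. \<forall>n\<ge>N. dist u p \<le> d + 1 / real (Suc n)"
      using p by (auto simp: W_def)
  qed
  with dle p that show ?thesis
    by (force simp: W_def dist_norm norm_minus_commute intro: order_trans)
qed

lemma metric_proj_nearest:
  fixes D :: "'a::{real_inner, complete_space} set"
  assumes "closed D" "convex D" "D \<noteq> {}"
  shows metric_proj_in: "metric_proj D u \<in> D"
    and metric_proj_le: "z \<in> D \<Longrightarrow> norm (u - metric_proj D u) \<le> norm (u - z)"
proof -
  obtain p where p: "p \<in> D" "\<And>z. z \<in> D \<Longrightarrow> norm (u - p) \<le> norm (u - z)"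
    using nearest_point_exists[OF assms] by blast
  have "metric_proj D u = p"
    unfolding metric_proj_def
  proof (rule the_equality)
    show "p \<in> D \<and> (\<forall>z\<in>D. norm (u - p) \<le> norm (u - z))" using p by blast
    show "q = p" if "q \<in> D \<and> (\<forall>z\<in>D. norm (u - q) \<le> norm (u - z))" for q
      using any_closest_point_unique[of D q p u] assms that p by (simp add: dist_norm)
  qed
  with p show "metric_proj D u \<in> D"
      and "z \<in> D \<Longrightarrow> norm (u - metric_proj D u) \<le> norm (u - z)"
    by auto
qed

text \<open>
The variational inequality: seen from the projection, every point of \<open>D\<close> makes an obtuse angle with
the projected point \<open>u\<close>. It has the shape of the condition that defines the sets \<open>Q n\<close>.
\<close>
lemma metric_proj_obtuse:
  fixes D :: "'a::{real_inner, complete_space} set"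
  assumes "closed D" "convex D" "z \<in> D"
  shows "inner (z - metric_proj D u) (metric_proj D u - u) \<ge> 0"
proof -
  have ne: "D \<noteq> {}" using assms by auto
  have "inner (u - metric_proj D u) (z - metric_proj D u) \<le> 0"
    using any_closest_point_dot[of D "metric_proj D u" z u] assms
      metric_proj_in[OF assms(1,2) ne] metric_proj_le[OF assms(1,2) ne]
    by (simp add: dist_norm)
  then show ?thesis
    by (simp add: inner_commute algebra_simps)
qed

text \<open>
The form in which obtuse angles are exploited: distances to a projection are controlled by a
difference of squared distances to \<open>u\<close>.
\<close>
lemma norm_sq_ge_of_obtuse:
  fixes p z u :: "'a::real_inner"
  assumes "inner (z - p) (p - u) \<ge> 0"
  shows "(norm (z - p))\<^sup>2 \<le> (norm (z - u))\<^sup>2 - (norm (p - u))\<^sup>2"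
proof -
  have eq: "(z - p) + (p - u) = z - u" by simp
  have "(norm (z - u))\<^sup>2 = (norm (z - p))\<^sup>2 + (norm (p - u))\<^sup>2 + 2 * inner (z - p) (p - u)"
    using dot_norm[of "z - p" "p - u", unfolded eq] by simp
  then show ?thesis using assms by simp
qed

section \<open>Nested closed convex sets\<close>

lemma Cauchy_of_squared_increments:
  fixes f :: "nat \<Rightarrow> real" and w :: "nat \<Rightarrow> 'a::real_normed_vector"
  assumes "convergent f" and "\<And>m n. n \<le> m \<Longrightarrow> (norm (w m - w n))\<^sup>2 \<le> f m - f n"
  shows "Cauchy w"
proof (rule CauchyI')
  fix e :: real assume "e > 0"
  then have "e\<^sup>2 > 0" by simp
  with assms(1) obtain N where N: "\<And>m n. m \<ge> N \<Longrightarrow> n \<ge> N \<Longrightarrow> norm (f m - f n) < e\<^sup>2"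
    using convergent_Cauchy CauchyD by metis
  have "norm (w m - w n) < e" if "m \<ge> N" "n > m" for m n
  proof -
    have "(norm (w n - w m))\<^sup>2 < e\<^sup>2"
      using assms(2)[of m n] N[of n m] that by auto
    then show ?thesis
      using \<open>e > 0\<close> by (simp add: norm_minus_commute power2_less_imp_less)
  qed
  then show "\<exists>M. \<forall>m\<ge>M. \<forall>n>m. dist (w m) (w n) < e"
    unfolding dist_norm by blast
qed

text \<open>
A substitute for weak sequential compactness. The nearest points \<open>w n\<close> of \<open>K n\<close> to \<open>u\<close> have
distances to \<open>u\<close> that increase with \<open>n\<close> and never exceed the distance from \<open>u\<close> to \<open>F\<close>. These
distances converge, so by the obtuse angles at the \<open>w n\<close> the points \<open>w n\<close> form a Cauchy sequence.
Its limit lies in \<open>F\<close> and is no further from \<open>u\<close> than the projection, so it is the projection. The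
obtuse angle at \<open>w n\<close> also forces \<open>x n - w n\<close> to 0.
\<close>
lemma nested_convex_convergence:
  fixes K :: "nat \<Rightarrow> 'a::{real_inner, complete_space} set"
  assumes cl: "\<And>n. closed (K n)" and cv: "\<And>n. convex (K n)"
    and dec: "\<And>m n. n \<le> m \<Longrightarrow> K m \<subseteq> K n"
    and F: "closed F" "convex F" and sub: "(\<Inter>n. K n) \<subseteq> F"
    and x: "\<And>n. x n \<in> K n"
    and bd: "\<And>n. norm (x n - u) \<le> norm (metric_proj F u - u)"
  shows "x \<longlonglongrightarrow> metric_proj F u"
proof -
  define q where "q = metric_proj F u"
  define w where "w n = metric_proj (K n) u" for n
  have ne: "K n \<noteq> {}" for n using x by auto
  have wK: "w n \<in> K n" for n
    unfolding w_def by (rule metric_proj_in[OF cl cv ne])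
  have pyth: "(norm (z - w n))\<^sup>2 \<le> (norm (z - u))\<^sup>2 - (norm (w n - u))\<^sup>2" if "z \<in> K n" for z n
    using norm_sq_ge_of_obtuse[OF metric_proj_obtuse[OF cl cv that]] by (simp add: w_def)
  define f where "f n = (norm (w n - u))\<^sup>2" for n
  have inc: "(norm (w m - w n))\<^sup>2 \<le> f m - f n" if "n \<le> m" for m n
    using pyth[of "w m" n] wK[of m] dec[OF that] by (auto simp: f_def)
  have fx: "(norm (x n - w n))\<^sup>2 \<le> (norm (q - u))\<^sup>2 - f n" for n
  proof -
    have "(norm (x n - u))\<^sup>2 \<le> (norm (q - u))\<^sup>2"
      unfolding q_def by (intro power_mono bd norm_ge_zero)
    then show ?thesis using pyth[OF x, of n] unfolding f_def by linarith
  qed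
  have "convergent f"
  proof (rule Bseq_mono_convergent)
    have "\<bar>f n\<bar> \<le> (norm (q - u))\<^sup>2" for n
      using fx[of n] by (smt (verit) f_def zero_le_power2)
    then show "Bseq f" by (intro BseqI') auto
    show "\<forall>m n. m \<le> n \<longrightarrow> f m \<le> f n"
      using inc by (smt (verit) zero_le_power2)
  qed
  then have "convergent w"
    using Cauchy_of_squared_increments inc Cauchy_convergent by blast
  then obtain p where p: "w \<longlonglongrightarrow> p" by (auto simp: convergent_def)
  have "p \<in> K n" for n
  proof (rule closed_sequentially[OF cl])
    show "(\<lambda>m. w (m + n)) \<longlonglongrightarrow> p" using p by (rule LIMSEQ_ignore_initial_segment)
    show "w (m + n) \<in> K n" for m using wK[of "m + n"] dec[of n "m + n"] by auto
  qed
  then have pF: "p \<in> F" using sub by auto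
  have fp: "f \<longlonglongrightarrow> (norm (p - u))\<^sup>2"
    unfolding f_def by (intro tendsto_intros p)
  have "(norm (p - u))\<^sup>2 \<le> (norm (q - u))\<^sup>2"
    using fp fx by (intro LIMSEQ_le_const2[OF fp]) (smt (verit) zero_le_power2)
  moreover have "(norm (p - q))\<^sup>2 \<le> (norm (p - u))\<^sup>2 - (norm (q - u))\<^sup>2"
    using norm_sq_ge_of_obtuse[OF metric_proj_obtuse[OF F pF]] by (simp add: q_def)
  ultimately have "(norm (p - q))\<^sup>2 \<le> 0" by linarith
  then have pq: "p = q" by simp
  have "(\<lambda>n. (norm (x n - w n))\<^sup>2) \<longlonglongrightarrow> 0"
  proof (rule tendsto_sandwich[OF _ _ tendsto_const])
    show "(\<lambda>n. (norm (q - u))\<^sup>2 - f n) \<longlonglongrightarrow> 0"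
      using tendsto_diff[OF tendsto_const fp, of "(norm (q - u))\<^sup>2"] pq by simp
  qed (use fx in auto)
  then have "(\<lambda>n. sqrt ((norm (x n - w n))\<^sup>2)) \<longlonglongrightarrow> sqrt 0"
    by (rule tendsto_real_sqrt)
  then have "(\<lambda>n. x n - w n) \<longlonglongrightarrow> 0"
    by (simp add: tendsto_norm_zero_iff)
  from tendsto_add[OF this p] show ?thesis
    by (simp add: pq q_def)
qed

section \<open>Fixed points of pseudo-contractions\<close>

text \<open>
Expanding the square in the definition shows that pseudo-contractivity of \<open>T\<close> is monotonicity of
\<open>I - T\<close>.
\<close>
lemma pseudo_contraction_monotone:
  assumes "pseudo_contraction_on C T" "x \<in> C" "y \<in> C"
  shows "inner (x - T x) (x - y) \<ge> inner (y - T y) (x - y)"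
proof -
  have "(norm (T x - T y))\<^sup>2 \<le> (norm (x - y))\<^sup>2 + (norm ((x - T x) - (y - T y)))\<^sup>2"
    using assms by (auto simp: pseudo_contraction_on_def)
  moreover have "T x - T y = (x - y) - ((x - T x) - (y - T y))" by simp
  then have "(norm (T x - T y))\<^sup>2 = (norm (x - y))\<^sup>2 + (norm ((x - T x) - (y - T y)))\<^sup>2
      - 2 * inner ((x - T x) - (y - T y)) (x - y)"
    by (metis (no_types, lifting) power2_norm_eq_inner inner_diff_left inner_diff_right
        inner_commute diff_add_eq diff_diff_eq2 add_diff_eq mult_2)
  ultimately show ?thesis by (simp add: inner_diff_left)
qed

text \<open>
Minty's argument: test the inequality at points \<open>s\<close> of the segment from \<open>z\<close> to \<open>T z\<close>, cancel the
positive step length and let it tend to 0. By continuity the inequality becomes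
\<open>inner (z - T z) (T z - z) \<ge> 0\<close>.
\<close>
lemma fixed_point_of_variational_inequality:
  fixes C :: "'a::real_inner set"
  assumes "convex C" "T \<in> C \<rightarrow> C" "continuous_on C T" "z \<in> C"
    and vi: "\<And>y. y \<in> C \<Longrightarrow> inner (y - T y) (y - z) \<ge> 0"
  shows "T z = z"
proof -
  define t :: "nat \<Rightarrow> real" where "t n = 1 / Suc n" for n
  define s where "s n = z + t n *\<^sub>R (T z - z)" for n
  have t: "0 < t n" "t n \<le> 1" for n by (auto simp: t_def)
  have t0: "t \<longlonglongrightarrow> 0" unfolding t_def by (rule LIMSEQ_Suc[OF lim_1_over_n])
  have sC: "s n \<in> C" for n
  proof -
    have "(1 - t n) *\<^sub>R z + t n *\<^sub>R T z \<in> C"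
      using assms t[of n] by (intro convexD) auto
    then show ?thesis by (simp add: s_def algebra_simps)
  qed
  have "inner (s n - T (s n)) (T z - z) \<ge> 0" for n
    using vi[OF sC[of n]] t[of n] by (simp add: s_def zero_le_mult_iff)
  moreover have "s \<longlonglongrightarrow> z + 0 *\<^sub>R (T z - z)"
    unfolding s_def by (intro tendsto_intros t0)
  then have s: "s \<longlonglongrightarrow> z" by simp
  then have "(\<lambda>n. T (s n)) \<longlonglongrightarrow> T z"
    using sC by (intro continuous_on_tendsto_compose[OF assms(3) _ assms(4)]) auto
  with s have "(\<lambda>n. inner (s n - T (s n)) (T z - z)) \<longlonglongrightarrow> inner (z - T z) (T z - z)"
    by (intro tendsto_intros)
  ultimately have "inner (z - T z) (T z - z) \<ge> 0"
    by (intro LIMSEQ_le_const) auto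
  then have "inner (T z - z) (T z - z) \<le> 0"
    by (simp add: inner_diff_left)
  then show ?thesis by (simp flip: power2_norm_eq_inner)
qed

text \<open>
The fixed point equation is not convex in \<open>z\<close>; this family of half-spaces, each affine in \<open>z\<close>,
replaces it, and so gives closedness, convexity and compatibility with closed convex hulls.
\<close>
lemma fixed_points_eq_halfspaces:
  fixes C :: "'a::real_inner set"
  assumes "convex C" "T \<in> C \<rightarrow> C" "continuous_on C T" "pseudo_contraction_on C T"
  shows "fixed_points C T = C \<inter> (\<Inter>y\<in>C. {z. inner (y - T y) z \<le> inner (y - T y) y})"
proof (intro set_eqI iffI)
  fix z assume "z \<in> fixed_points C T"
  then have z: "z \<in> C" "T z = z" by (auto simp: fixed_points_def)
  have "inner (y - T y) z \<le> inner (y - T y) y" if "y \<in> C" for y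
  proof -
    have "inner (z - T z) (y - z) \<le> inner (y - T y) (y - z)"
      by (rule pseudo_contraction_monotone[OF assms(4) that z(1)])
    then show ?thesis by (simp add: z(2) inner_diff_right)
  qed
  with z(1) show "z \<in> C \<inter> (\<Inter>y\<in>C. {z. inner (y - T y) z \<le> inner (y - T y) y})"
    by blast
next
  fix z assume "z \<in> C \<inter> (\<Inter>y\<in>C. {z. inner (y - T y) z \<le> inner (y - T y) y})"
  then have z: "z \<in> C" "\<And>y. y \<in> C \<Longrightarrow> inner (y - T y) z \<le> inner (y - T y) y" by blast+
  have "T z = z"
    using z(2) by (intro fixed_point_of_variational_inequality[OF assms(1-3) z(1)])
      (simp add: inner_diff_right)
  with z(1) show "z \<in> fixed_points C T" by (simp add: fixed_points_def)
qed

lemma closed_fixed_points: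
  fixes C :: "'a::real_inner set"
  assumes "closed C" "convex C" "T \<in> C \<rightarrow> C" "continuous_on C T" "pseudo_contraction_on C T"
  shows "closed (fixed_points C T)"
  unfolding fixed_points_eq_halfspaces[OF assms(2-5)]
  by (intro closed_Int closed_INT ballI closed_halfspace_le assms(1))

lemma convex_fixed_points:
  fixes C :: "'a::real_inner set"
  assumes "convex C" "T \<in> C \<rightarrow> C" "continuous_on C T" "pseudo_contraction_on C T"
  shows "convex (fixed_points C T)"
  unfolding fixed_points_eq_halfspaces[OF assms]
  by (intro convex_Int convex_INT convex_halfspace_le assms(1))

text \<open>
Demiclosedness of \<open>I - T\<close> at 0 without weak topologies. By monotonicity the tail of \<open>x\<close> satisfies each
inequality of \<open>fixed_points_eq_halfspaces\<close> up to an arbitrarily small error. A relaxed half-space is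
closed and convex, so it contains the closed convex hull of that tail.
\<close>
lemma tail_hull_points_are_fixed:
  fixes C :: "'a::real_inner set"
  assumes C: "closed C" "convex C" and T: "T \<in> C \<rightarrow> C" "continuous_on C T" "pseudo_contraction_on C T"
    and x: "\<And>n. x n \<in> C" "bounded (range x)" and res: "(\<lambda>n. x n - T (x n)) \<longlonglongrightarrow> 0"
  shows "(\<Inter>n. closure (convex hull (x ` {n..}))) \<subseteq> fixed_points C T"
proof
  fix z assume z: "z \<in> (\<Inter>n. closure (convex hull (x ` {n..})))"
  have "closure (convex hull (x ` {0..})) \<subseteq> C"
    using C x by (intro closure_minimal hull_minimal) auto
  then have zC: "z \<in> C" using z[THEN INT_D, of 0] by blast
  have "inner (y - T y) z \<le> inner (y - T y) y" if y: "y \<in> C" for y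
  proof (rule field_le_epsilon)
    fix e :: real assume e: "e > 0"
    have "bounded (range (\<lambda>n. y - x n))"
      using bounded_minus_comp[of "\<lambda>_. y" UNIV x] x(2) by simp
    then have "Bfun (\<lambda>n. y - x n) sequentially" by (simp add: Bseq_eq_bounded)
    moreover have "Zfun (\<lambda>n. x n - T (x n)) sequentially"
      using res by (simp add: tendsto_Zfun_iff)
    ultimately have "Zfun (\<lambda>n. inner (x n - T (x n)) (y - x n)) sequentially"
      by (intro bounded_bilinear.Zfun_prod_Bfun[OF bounded_bilinear_inner])
    then have "(\<lambda>n. inner (x n - T (x n)) (y - x n)) \<longlonglongrightarrow> 0"
      by (simp add: tendsto_Zfun_iff)
    then have "\<forall>\<^sub>F n in sequentially. inner (x n - T (x n)) (y - x n) > - e"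
      using e by (intro order_tendstoD(1)) auto
    then obtain N where N: "\<And>n. n \<ge> N \<Longrightarrow> inner (x n - T (x n)) (y - x n) > - e"
      by (auto simp: eventually_sequentially)
    have "inner (y - T y) (x n) \<le> inner (y - T y) y + e" if "n \<ge> N" for n
      using N[OF that] pseudo_contraction_monotone[OF T(3) y x(1)[of n]]
      by (simp add: inner_diff_right)
    then have "closure (convex hull (x ` {N..})) \<subseteq> {z. inner (y - T y) z \<le> inner (y - T y) y + e}"
      by (intro closure_minimal hull_minimal closed_halfspace_le convex_halfspace_le) auto
    then show "inner (y - T y) z \<le> inner (y - T y) y + e" using z[THEN INT_D, of N] by blast
  qed
  with zC show "z \<in> fixed_points C T"
    by (simp add: fixed_points_eq_halfspaces[OF C(2) T])
qed

section \<open>Strong convergence of the projection method\<close>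

theorem theorem7p1:
  fixes C :: "'a::{real_inner, complete_space} set"
    and T :: "'a \<Rightarrow> 'a"
    and L \<tau> a b :: real
    and \<tau>s \<alpha> \<beta> \<theta> :: "nat \<Rightarrow> real"
    and x y v :: "nat \<Rightarrow> 'a"
    and C' C'' Cn Cstar Q :: "nat \<Rightarrow> 'a set"
  assumes "C \<noteq> {}" and "closed C" and "convex C"
    and "T \<in> C \<rightarrow> C"
    and "L \<ge> 1" and "L-lipschitz_on C T"
    and "pseudo_contraction_on C T"
    and "fixed_points C T \<noteq> {}"
    and "\<tau> \<in> {0<..1}" and "\<And>n. \<tau>s n \<in> {\<tau>..1}"
    and "a \<in> {0<..<1 / (L + 1)}" and "b \<in> {0<..<1 / (L + 1)}"
    and "\<And>n. \<alpha> n \<in> {a..b}"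
    and "\<And>n. \<beta> n \<in> {0..1}"
    and "x 0 \<in> C"
    and "\<And>n. y n = (1 - \<beta> n) *\<^sub>R x 0 + \<beta> n *\<^sub>R T (x n)"
    and "\<And>n. v n = (1 - \<alpha> n) *\<^sub>R x n + \<alpha> n *\<^sub>R T (x n)"
    and "\<And>n. C' n = {z \<in> C.
           \<tau>s n * \<alpha> n * (1 - (1 + L) * \<alpha> n) * (norm (x n - T (x n)))\<^sup>2
             \<le> inner (x n - z) (v n - T (v n))}"
    and "\<And>n. \<theta> n = (1 - \<beta> n) * ((norm (x 0))\<^sup>2 - (norm (x n))\<^sup>2)
           + \<beta> n * (norm (x n - T (x n)))\<^sup>2
           - \<beta> n * (1 - \<beta> n) * (norm (x 0 - T (x n)))\<^sup>2"
    and "\<And>n. C'' n = {z \<in> C.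
           (norm (y n - z))\<^sup>2
             \<le> (norm (x n - z))\<^sup>2 + 2 * (1 - \<beta> n) * inner (x n - x 0) z + \<theta> n}"
    and "\<And>n. Cn n = C' n \<inter> C'' n"
    and "\<And>n. closed (Cstar n)" and "\<And>n. convex (Cstar n)"
    and "\<And>n. fixed_points C T \<subseteq> Cstar n" and "\<And>n. Cstar n \<subseteq> Cn n"
    and "\<And>n. Q n = {z \<in> C. inner (z - x n) (x n - x 0) \<ge> 0}"
    and "\<And>n. x (Suc n) = metric_proj (Cstar n \<inter> Q n) (x 0)"
  shows "x \<longlonglongrightarrow> metric_proj (fixed_points C T) (x 0)"
proof -
  define F where "F = fixed_points C T"
  define u where "u = x 0"
  define q where "q = metric_proj F u"
  have cont: "continuous_on C T" by (rule lipschitz_on_continuous_on[OF assms(6)])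
  have F: "closed F" "convex F" "F \<noteq> {}"
    unfolding F_def
    using closed_fixed_points[OF assms(2-4) cont assms(7)]
      convex_fixed_points[OF assms(3,4) cont assms(7)] assms(8) by auto
  have qF: "q \<in> F" unfolding q_def by (rule metric_proj_in[OF F])
  then have q: "q \<in> C" "T q = q" by (auto simp: F_def fixed_points_def)
  have D: "closed (Cstar n \<inter> Q n)" "convex (Cstar n \<inter> Q n)" for n
  proof -
    have "inner (z - x n) (x n - u) = inner (x n - u) z - inner (x n - u) (x n)" for z
      by (subst inner_commute) (rule inner_diff_right)
    then have Q: "Q n = C \<inter> {z. inner (x n - u) z \<ge> inner (x n - u) (x n)}"
      by (auto simp: assms(26) u_def)
    show "closed (Cstar n \<inter> Q n)"
      unfolding Q by (intro closed_Int closed_halfspace_ge assms(2,22))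
    show "convex (Cstar n \<inter> Q n)"
      unfolding Q by (intro convex_Int convex_halfspace_ge assms(3,23))
  qed
  \<comment> \<open>Well-definedness of the iteration: the projections exist because the sets contain \<open>F\<close>, and \<open>F\<close>
    stays in the next \<open>Q\<close> because \<open>x (Suc n)\<close> is a projection. The induction starts from \<open>Q 0 = C\<close>.\<close>
  have FD: "F \<subseteq> Cstar n \<inter> Q n \<and> x n \<in> C" for n
  proof (induction n)
    case 0
    show ?case using assms(15,24) by (auto simp: F_def fixed_points_def assms(26))
  next
    case (Suc n)
    with F have ne: "Cstar n \<inter> Q n \<noteq> {}" by auto
    have "x (Suc n) \<in> C"
      using metric_proj_in[OF D ne, of "x 0"] by (simp add: assms(26,27))
    moreover have "inner (z - x (Suc n)) (x (Suc n) - x 0) \<ge> 0" if "z \<in> F" for z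
      using metric_proj_obtuse[OF D, of z n "x 0"] Suc that assms(27)[of n] by auto
    ultimately show ?case
      using assms(24) by (auto simp: assms(26) F_def fixed_points_def)
  qed
  have xD: "x (Suc n) \<in> Cstar n \<inter> Q n" for n
    using metric_proj_in[OF D, of n "x 0"] FD[of n] F(3) by (auto simp: assms(27))
  have xC: "x n \<in> C" for n using FD by blast
  have bd: "norm (x n - u) \<le> norm (q - u)" for n
  proof (cases n)
    case 0
    then show ?thesis by (simp add: u_def)
  next
    case (Suc m)
    have "norm (x 0 - x (Suc m)) \<le> norm (x 0 - q)"
      using metric_proj_le[OF D, of m q "x 0"] qF FD[of m] by (auto simp: assms(27))
    then show ?thesis by (simp add: Suc u_def norm_minus_commute)
  qed
  have step: "(norm (x (Suc n) - x n))\<^sup>2 \<le> (norm (x (Suc n) - u))\<^sup>2 - (norm (x n - u))\<^sup>2" for n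
    using xD[of n] by (intro norm_sq_ge_of_obtuse) (simp add: assms(26) u_def)
  have diff0: "(\<lambda>n. norm (x n - x (Suc n))) \<longlonglongrightarrow> 0"
  proof -
    define f where "f n = (norm (x n - u))\<^sup>2" for n
    have "convergent f"
    proof (rule Bseq_mono_convergent)
      show "Bseq f"
        using bd by (intro BseqI'[of _ "(norm (q - u))\<^sup>2"]) (simp add: f_def)
      have "incseq f"
        by (intro incseq_SucI) (smt (verit) f_def step zero_le_power2)
      then show "\<forall>m n. m \<le> n \<longrightarrow> f m \<le> f n" by (auto simp: incseq_def)
    qed
    then obtain l where l: "f \<longlonglongrightarrow> l" by (auto simp: convergent_def)
    from tendsto_diff[OF LIMSEQ_Suc[OF l] l]
    have f0: "(\<lambda>n. f (Suc n) - f n) \<longlonglongrightarrow> 0" by simp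
    have "(\<lambda>n. (norm (x (Suc n) - x n))\<^sup>2) \<longlonglongrightarrow> 0"
      by (rule tendsto_sandwich[OF _ _ tendsto_const f0]) (use step in \<open>auto simp: f_def\<close>)
    from tendsto_real_sqrt[OF this] show ?thesis by (simp add: norm_minus_commute)
  qed
  define R where "R = 2 * norm (q - u)"
  have R: "norm (x n - q) \<le> R" for n
    using bd[of n] norm_triangle_ineq4[of "x n - u" "q - u"] by (simp add: R_def)
  have lip: "norm (T z - q) \<le> L * norm (z - q)" if "z \<in> C" for z
    using lipschitz_onD[OF assms(6) that q(1)] q(2) by (simp add: dist_norm)
  have L0: "L \<ge> 0" using assms(5) by simp
  have a0: "0 < a" using assms(11) by simp
  have b1: "(1 + L) * b < 1" using assms(12) L0 by (simp add: field_simps)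
  have ab: "a \<le> \<alpha> n" "\<alpha> n \<le> b" "0 \<le> \<alpha> n" "\<alpha> n \<le> 1" for n
  proof -
    show \<alpha>: "a \<le> \<alpha> n" "\<alpha> n \<le> b" using assms(13)[of n] by auto
    then show "0 \<le> \<alpha> n" using a0 by simp
    have "0 \<le> L * b" using L0 assms(12) by simp
    then show "\<alpha> n \<le> 1" using b1 \<alpha> by (simp add: algebra_simps)
  qed
  have vbd: "norm (v n - T (v n)) \<le> (1 + L) * (L * R + R)" for n
  proof -
    have vC: "v n \<in> C"
      unfolding assms(17) using ab[of n] xC[of n] assms(3,4) by (intro convexD) auto
    have "v n - q = (1 - \<alpha> n) *\<^sub>R (x n - q) + \<alpha> n *\<^sub>R (T (x n) - q)"
      by (simp add: assms(17) algebra_simps)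
    then have "norm (v n - q) \<le> (1 - \<alpha> n) * norm (x n - q) + \<alpha> n * norm (T (x n) - q)"
      using norm_triangle_ineq[of "(1 - \<alpha> n) *\<^sub>R (x n - q)" "\<alpha> n *\<^sub>R (T (x n) - q)"] ab[of n]
      by simp
    also have "\<dots> \<le> 1 * R + 1 * (L * R)"
      using ab[of n] R[of n] lip[OF xC[of n]] mult_left_mono[OF R[of n] L0] L0
      by (intro add_mono mult_mono) auto
    finally have vq: "norm (v n - q) \<le> L * R + R" by simp
    have "norm (v n - T (v n)) \<le> norm (v n - q) + norm (T (v n) - q)"
      using norm_triangle_ineq4[of "v n - q" "T (v n) - q"] by simp
    also have "\<dots> \<le> (1 + L) * norm (v n - q)"
      using lip[OF vC] by (simp add: algebra_simps)
    finally show ?thesis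
      using mult_left_mono[OF vq, of "1 + L"] L0 by linarith
  qed
  \<comment> \<open>A lower bound, independent of \<open>n\<close>, for the coefficient in the definition of \<open>C' n\<close>; it is positive
    since \<open>b < 1 / (L + 1)\<close>.\<close>
  define c where "c = \<tau> * a * (1 - (1 + L) * b)"
  have c: "c > 0" using assms(9) a0 b1 by (simp add: c_def)
  have res_le: "c * (norm (x n - T (x n)))\<^sup>2
      \<le> norm (x n - x (Suc n)) * ((1 + L) * (L * R + R))" for n
  proof -
    have "(1 + L) * \<alpha> n \<le> (1 + L) * b" using ab[of n] L0 by (intro mult_left_mono) auto
    then have "c \<le> \<tau>s n * \<alpha> n * (1 - (1 + L) * \<alpha> n)"
      unfolding c_def using assms(9) assms(10)[of n] a0 b1 ab[of n] by (intro mult_mono) auto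
    then have "c * (norm (x n - T (x n)))\<^sup>2
        \<le> \<tau>s n * \<alpha> n * (1 - (1 + L) * \<alpha> n) * (norm (x n - T (x n)))\<^sup>2"
      by (intro mult_right_mono) auto
    also have "\<dots> \<le> inner (x n - x (Suc n)) (v n - T (v n))"
    proof -
      have "x (Suc n) \<in> C' n" using xD[of n] assms(25)[of n] by (auto simp: assms(21))
      then show ?thesis by (simp add: assms(18))
    qed
    also have "\<dots> \<le> norm (x n - x (Suc n)) * norm (v n - T (v n))"
      by (rule norm_cauchy_schwarz)
    also have "\<dots> \<le> norm (x n - x (Suc n)) * ((1 + L) * (L * R + R))"
      by (intro mult_left_mono vbd) auto
    finally show ?thesis .
  qed
  have res: "(\<lambda>n. x n - T (x n)) \<longlonglongrightarrow> 0"
  proof -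
    have bound0: "(\<lambda>n. norm (x n - x (Suc n)) * ((1 + L) * (L * R + R) / c)) \<longlonglongrightarrow> 0"
      by (rule tendsto_mult_left_zero[OF diff0])
    have "(\<lambda>n. (norm (x n - T (x n)))\<^sup>2) \<longlonglongrightarrow> 0"
      by (rule tendsto_sandwich[OF _ _ tendsto_const bound0])
        (use res_le c in \<open>auto simp: field_simps\<close>)
    from tendsto_real_sqrt[OF this] show ?thesis by (simp add: tendsto_norm_zero_iff)
  qed
  have "bounded (range x)"
  proof -
    have "dist q (x n) \<le> R" for n using R[of n] by (simp add: dist_norm norm_minus_commute)
    then show ?thesis unfolding bounded_def by blast
  qed
  then have "(\<Inter>n. closure (convex hull (x ` {n..}))) \<subseteq> F"
    unfolding F_def by (rule tail_hull_points_are_fixed[OF assms(2-4) cont assms(7) xC _ res])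
  then have "x \<longlonglongrightarrow> metric_proj F u"
  proof (rule nested_convex_convergence[rotated 5])
    show "closure (convex hull (x ` {m..})) \<subseteq> closure (convex hull (x ` {n..}))"
      if "n \<le> m" for m n
      using that by (intro closure_mono hull_mono image_mono) auto
    show "x n \<in> closure (convex hull (x ` {n..}))" for n
      using closure_subset hull_subset by (metis atLeast_iff imageI order_refl subsetD)
  qed (use F bd in \<open>auto simp: q_def\<close>)
  then show ?thesis by (simp add: F_def u_def)
qed

end
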